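(* Let $R$ be a commutative ring, let $\theta:R\to S$ be a surjective ring homomorphism, let $n\ge 1$, and let $\Theta:M_n(R)\to M_n(S)$ be the induced epimorphism $\Theta([b_{ij}])=[\theta(b_{ij})]$. Let $B=[b_{ij}]\in M_n(R)$, and write $\hat b_{ij}=\theta(b_{ij})$ and $\widehat B=\Theta(B)$. Then $$\Theta(\mathrm{Cen}(B))+[\mathcal A_{ij}]\subseteq\mathrm{Cen}(\widehat B),$$ where $$\mathcal A_{ij}=\left(\bigcap_{k,\ k\neq j}\mathrm{ann}(\hat b_{jk})\right)\cap\left(\bigcap_{k,\ k\neq i}\mathrm{ann}(\hat b_{ki})\right)\cap\mathrm{ann}(\hat b_{ii}-\hat b_{jj}).$$
   Context: $\mathrm{Cen}(B)$ is the centralizer of $B$ in $M_n(R)$ and $\mathrm{Cen}(\widehat B)$ is the centralizer of $\widehat B$ in $M_n(S)$. For $s\in S$, $\mathrm{ann}(s)=\{x\in S: xs=0\}$. $[\mathcal A_{ij}]$ denotes the set of all matrices in $M_n(S)$ whose $(i,j)$ entry lies in $\mathcal A_{ij}$ for all $i,j$. An intersection over an empty index set is $S$. The sum of two sets of matrices is the set of all sums. *)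

theory Defs
  imports "Jordan_Normal_Form.Matrix" "HOL-Library.Set_Algebras"
begin

(* Matrices of size n are indexed by 0, ..., n - 1.  The rings are taken in the type classes
   comm_ring and ring, which do not ask for a unit: in this way the zero ring, which is a possible
   surjective image S but is excluded by comm_ring_1, is covered. *)

definition Cen :: "nat \<Rightarrow> 'a::ring mat \<Rightarrow> 'a mat set" where
  "Cen n B = {A \<in> carrier_mat n n. A * B = B * A}"

definition ann :: "'a::ring \<Rightarrow> 'a set" where
  "ann s = {x. x * s = 0}"

definition entries_in :: "nat \<Rightarrow> (nat \<Rightarrow> nat \<Rightarrow> 'a set) \<Rightarrow> 'a mat set" where
  "entries_in n \<A> = {C \<in> carrier_mat n n. \<forall>i<n. \<forall>j<n. C $$ (i, j) \<in> \<A> i j}"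

(* Intersections over an empty index set are UNIV, i.e. the whole ring. *)
definition ann_entry :: "nat \<Rightarrow> 'a::ring mat \<Rightarrow> nat \<Rightarrow> nat \<Rightarrow> 'a set" where
  "ann_entry n B i j =
     (\<Inter>k\<in>{k. k < n \<and> k \<noteq> j}. ann (B $$ (j, k))) \<inter>
     (\<Inter>k\<in>{k. k < n \<and> k \<noteq> i}. ann (B $$ (k, i))) \<inter>
     ann (B $$ (i, i) - B $$ (j, j))"

(* The library's ring_hom lives on rings with 1 \<noteq> 0; these are its additive and multiplicative
   parts.  A surjective map with these properties between unital rings preserves 1. *)
locale surj_ring_hom = ab_group_add_hom \<theta> + semigroup_mult_hom \<theta>
  for \<theta> :: "'a::comm_ring \<Rightarrow> 'b::ring" +
  assumes surj: "surj \<theta>"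

end

theory Submission
  imports Defs
begin

text \<open>If every entry of \<open>C\<close> annihilates the entries of \<open>B\<close> prescribed by \<open>ann_entry\<close>, then all
  terms but one vanish in the sums for the \<open>(i, j)\<close> entries of \<open>C * B\<close> and \<open>B * C\<close>; the surviving
  terms \<open>c\<^sub>i\<^sub>j b\<^sub>j\<^sub>j\<close> and \<open>b\<^sub>i\<^sub>i c\<^sub>i\<^sub>j\<close> agree because \<open>c\<^sub>i\<^sub>j\<close> annihilates \<open>b\<^sub>i\<^sub>i - b\<^sub>j\<^sub>j\<close>.\<close>

lemma index_mult_mat_sum:
  assumes "A \<in> carrier_mat n n" "B \<in> carrier_mat n n" "i < n" "j < n"
  shows "(A * B) $$ (i, j) = (\<Sum>k<n. A $$ (i, k) * B $$ (k, j))"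
  using assms by (simp add: scalar_prod_def atLeast0LessThan)

lemma sum_eq_single_term:
  fixes f :: "nat \<Rightarrow> 'a::comm_monoid_add"
  assumes "j < n" "\<And>k. k < n \<Longrightarrow> k \<noteq> j \<Longrightarrow> f k = 0"
  shows "(\<Sum>k<n. f k) = f j"
  using assms by (subst sum.remove[of _ j]) (auto intro: sum.neutral)

text \<open>Commutativity is the explicit hypothesis \<open>comm\<close> because the codomain of
  \<open>\<theta>\<close> is only of class \<open>ring\<close>.\<close>

lemma entries_in_ann_entry_subset_Cen:
  fixes B :: "'a::ring mat"
  assumes comm: "\<And>x y :: 'a. x * y = y * x"
    and B: "B \<in> carrier_mat n n"
  shows "entries_in n (ann_entry n B) \<subseteq> Cen n B"
proof
  fix C assume "C \<in> entries_in n (ann_entry n B)"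
  then have C: "C \<in> carrier_mat n n"
    and entry: "\<And>i j. i < n \<Longrightarrow> j < n \<Longrightarrow> C $$ (i, j) \<in> ann_entry n B i j"
    by (auto simp: entries_in_def)
  have row: "C $$ (i, j) * B $$ (j, k) = 0" if "i < n" "j < n" "k < n" "k \<noteq> j" for i j k
    using entry[of i j] that by (auto simp: ann_entry_def ann_def)
  \<comment> \<open>\<open>ann\<close> puts the annihilating element on the left, whereas
    \<open>B * C\<close> has it on the right; \<open>comm\<close> swaps the factors.\<close>
  have col: "B $$ (k, i) * C $$ (i, j) = 0" if "i < n" "j < n" "k < n" "k \<noteq> i" for i j k
    using entry[of i j] that by (auto simp: ann_entry_def ann_def comm[of "B $$ (k, i)"])
  have diag: "C $$ (i, j) * B $$ (j, j) = B $$ (i, i) * C $$ (i, j)" if "i < n" "j < n" for i j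
    using entry[of i j] that
    by (auto simp: ann_entry_def ann_def right_diff_distrib comm[of "B $$ (i, i)"])
  have "C * B = B * C"
  proof (rule eq_matI)
    fix i j assume "i < dim_row (B * C)" "j < dim_col (B * C)"
    then have ij: "i < n" "j < n" using B C by auto
    have "(C * B) $$ (i, j) = C $$ (i, j) * B $$ (j, j)"
      unfolding index_mult_mat_sum[OF C B ij] using ij by (intro sum_eq_single_term) (auto simp: row)
    moreover have "(B * C) $$ (i, j) = B $$ (i, i) * C $$ (i, j)"
      unfolding index_mult_mat_sum[OF B C ij] using ij by (intro sum_eq_single_term) (auto simp: col)
    ultimately show "(C * B) $$ (i, j) = (B * C) $$ (i, j)"
      using diag ij by simp
  qed (use B C in auto)
  with C show "C \<in> Cen n B" by (simp add: Cen_def)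
qed

lemma Cen_add:
  assumes "B \<in> carrier_mat n n" "A \<in> Cen n B" "C \<in> Cen n B"
  shows "A + C \<in> Cen n B"
  using assms by (auto simp: Cen_def add_mult_distrib_mat mult_add_distrib_mat)

context surj_ring_hom
begin

lemma map_mat_mult:
  assumes "A \<in> carrier_mat n n" "B \<in> carrier_mat n n"
  shows "map_mat \<theta> (A * B) = map_mat \<theta> A * map_mat \<theta> B"
proof (rule eq_matI)
  fix i j assume "i < dim_row (map_mat \<theta> A * map_mat \<theta> B)" "j < dim_col (map_mat \<theta> A * map_mat \<theta> B)"
  then show "map_mat \<theta> (A * B) $$ (i, j) = (map_mat \<theta> A * map_mat \<theta> B) $$ (i, j)"
    using assms by (simp add: scalar_prod_def hom_sum hom_mult)
qed (use assms in auto)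

text \<open>Applying the multiplicative entrywise map to \<open>A * B = B * A\<close> gives the same
  relation between the images.\<close>

lemma map_mat_Cen_subset:
  assumes "B \<in> carrier_mat n n"
  shows "map_mat \<theta> ` Cen n B \<subseteq> Cen n (map_mat \<theta> B)"
  using assms by (auto simp: Cen_def simp flip: map_mat_mult[where n = n])

text \<open>By surjectivity both factors have preimages, which commute in the domain. This supplies
  \<open>comm\<close> for the codomain.\<close>

lemma codomain_commute: "x * y = y * (x :: 'b)"
proof -
  obtain a b where "x = \<theta> a" "y = \<theta> b" using surj by (metis surjD)
  then show ?thesis by (simp add: mult.commute flip: hom_mult)
qed

end

theorem proposition2p6:
  fixes \<theta> :: "'a::comm_ring \<Rightarrow> 'b::ring" and n :: nat and B :: "'a mat"
  assumes "surj_ring_hom \<theta>"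
    and "n \<ge> 1"
    and "B \<in> carrier_mat n n"
  shows "map_mat \<theta> ` Cen n B + entries_in n (ann_entry n (map_mat \<theta> B))
           \<subseteq> Cen n (map_mat \<theta> B)"
proof -
  interpret surj_ring_hom \<theta> by fact
  have B: "map_mat \<theta> B \<in> carrier_mat n n" using assms(3) by simp
  \<comment> \<open>Both summands lie in the centralizer of the image matrix, which is closed under
    addition.\<close>
  show ?thesis
    using map_mat_Cen_subset[OF assms(3)]
      entries_in_ann_entry_subset_Cen[OF codomain_commute B] Cen_add[OF B]
    by (blast elim: set_plus_elim)
qed

end
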